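(* Let $a,b$ be integers with $2\le a\le b$. Then $$Z_-(P_a\square P_b)=a-\mathbf 1_{\{a\text{ is odd and }b\text{ is even}\}},$$ and consequently $$\gamma_{\mathrm{gr}}^t(P_a\square P_b)=ab-a+\mathbf 1_{\{a\text{ is odd and }b\text{ is even}\}}.$$
   Context: All graphs are finite and simple. $P_n$ is the path on $n$ vertices. $\mathbf 1_{\mathcal P}$ equals $1$ if property $\mathcal P$ holds and $0$ otherwise. The Cartesian product $G\square H$ has vertex set $V(G)\times V(H)$, with $(u,x)$ adjacent to $(v,y)$ iff either $u=v$ and $xy\in E(H)$, or $x=y$ and $uv\in E(G)$. $N_G(v)$ denotes the open neighborhood of $v$. Skew zero forcing: vertices are colored blue or white. If a vertex $u$ of either color has exactly one white neighbor $v$, then $u$ may force $v$, i.e. $v$ becomes blue. A set $B\subseteq V(G)$ is a skew zero forcing set if, starting with exactly the vertices of $B$ blue, repeated legal forces can color all vertices blue. $Z_-(G)$ is the minimum cardinality of a skew zero forcing set. Grundy total domination: for $G$ without isolated vertices, a sequence $(v_1,\ldots,v_k)$ of distinct vertices is a legal open-neighborhood sequence if $N_G(v_i)\setminus\bigcup_{j=1}^{i-1}N_G(v_j)\neq\varnothing$ for every $1\le i\le k$. $\gamma_{\mathrm{gr}}^t(G)$ is the maximum length of a legal open-neighborhood sequence. *)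

theory Defs
  imports "Graph_Theory.Pair_Digraph"
begin

text \<open>Finite simple graphs are rendered by the locale \<^locale>\<open>pair_graph\<close>: a finite vertex set with a
  finite, symmetric, loop-free set of arcs between vertices. An edge \<open>uv\<close> is the pair of arcs
  \<open>(u, v)\<close> and \<open>(v, u)\<close>.\<close>

definition path_graph :: "nat \<Rightarrow> nat pair_pre_digraph" where
  "path_graph n =
     \<lparr> pverts = {0..<n},
       parcs = {(i, j). i < n \<and> j < n \<and> (j = Suc i \<or> i = Suc j)} \<rparr>"

definition cartesian_product ::
  "'a pair_pre_digraph \<Rightarrow> 'b pair_pre_digraph \<Rightarrow> ('a \<times> 'b) pair_pre_digraph"
  (infixr \<open>\<box>\<close> 80) where
  "G \<box> H =
     \<lparr> pverts = pverts G \<times> pverts H,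
       parcs = {((u, x), (v, y)).
                  u \<in> pverts G \<and> x \<in> pverts H \<and> v \<in> pverts G \<and> y \<in> pverts H \<and>
                  (u = v \<and> (x, y) \<in> parcs H \<or> x = y \<and> (u, v) \<in> parcs G)} \<rparr>"

definition open_nbhd :: "'a pair_pre_digraph \<Rightarrow> 'a \<Rightarrow> 'a set" where
  "open_nbhd G v = {w \<in> pverts G. (v, w) \<in> parcs G}"

text \<open>A colouring is given by its set of blue vertices. The forcing vertex \<open>u\<close> may be blue or white.\<close>

definition skew_force :: "'a pair_pre_digraph \<Rightarrow> 'a set \<Rightarrow> 'a set \<Rightarrow> bool" where
  "skew_force G B B' \<longleftrightarrow>
     (\<exists>u \<in> pverts G. \<exists>v. open_nbhd G u - B = {v} \<and> B' = insert v B)"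

definition skew_zero_forcing_set :: "'a pair_pre_digraph \<Rightarrow> 'a set \<Rightarrow> bool" where
  "skew_zero_forcing_set G B \<longleftrightarrow> B \<subseteq> pverts G \<and> (skew_force G)\<^sup>*\<^sup>* B (pverts G)"

definition skew_zero_forcing_number :: "'a pair_pre_digraph \<Rightarrow> nat" where
  "skew_zero_forcing_number G = Min (card ` {B. skew_zero_forcing_set G B})"

definition legal_open_nbhd_seq :: "'a pair_pre_digraph \<Rightarrow> 'a list \<Rightarrow> bool" where
  "legal_open_nbhd_seq G vs \<longleftrightarrow>
     distinct vs \<and> set vs \<subseteq> pverts G \<and>
     (\<forall>i < length vs. open_nbhd G (vs ! i) - (\<Union>j<i. open_nbhd G (vs ! j)) \<noteq> {})"

text \<open>Only meaningful for graphs without isolated vertices.\<close>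

definition grundy_total_domination_number :: "'a pair_pre_digraph \<Rightarrow> nat" where
  "grundy_total_domination_number G = Max (length ` {vs. legal_open_nbhd_seq G vs})"

text \<open>The minimum and the maximum above range over finite nonempty sets.\<close>

lemma skew_zero_forcing_cards_wf:
  assumes "finite (pverts G)"
  shows "finite (card ` {B. skew_zero_forcing_set G B})"
    and "card ` {B. skew_zero_forcing_set G B} \<noteq> {}"
proof -
  have "{B. skew_zero_forcing_set G B} \<subseteq> Pow (pverts G)"
    by (auto simp: skew_zero_forcing_set_def)
  then show "finite (card ` {B. skew_zero_forcing_set G B})"
    using assms by (meson finite_Pow_iff finite_imageI finite_subset)
  have "skew_zero_forcing_set G (pverts G)"
    by (simp add: skew_zero_forcing_set_def)
  then show "card ` {B. skew_zero_forcing_set G B} \<noteq> {}" by blast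
qed

lemma legal_open_nbhd_seq_lengths_wf:
  assumes "finite (pverts G)"
  shows "finite (length ` {vs. legal_open_nbhd_seq G vs})"
    and "length ` {vs. legal_open_nbhd_seq G vs} \<noteq> {}"
proof -
  have "length vs \<le> card (pverts G)" if "legal_open_nbhd_seq G vs" for vs
    using that assms by (metis card_mono distinct_card legal_open_nbhd_seq_def)
  then have "length ` {vs. legal_open_nbhd_seq G vs} \<subseteq> {..card (pverts G)}" by auto
  then show "finite (length ` {vs. legal_open_nbhd_seq G vs})"
    using finite_subset by blast
  have "legal_open_nbhd_seq G []" by (simp add: legal_open_nbhd_seq_def)
  then show "length ` {vs. legal_open_nbhd_seq G vs} \<noteq> {}" by blast
qed

lemma pair_graph_path_graph: "pair_graph (path_graph n)"
proof -
  have "parcs (path_graph n) \<subseteq> {0..<n} \<times> {0..<n}" by (auto simp: path_graph_def)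
  then have "finite (parcs (path_graph n))" by (rule finite_subset) simp
  then show ?thesis
    by unfold_locales (auto simp: path_graph_def symmetric_def sym_def)
qed

lemma pair_graph_cartesian_product:
  assumes "pair_graph G" "pair_graph H"
  shows "pair_graph (G \<box> H)"
proof -
  interpret G: pair_graph G by fact
  interpret H: pair_graph H by fact
  have symG: "(u, v) \<in> parcs G \<Longrightarrow> (v, u) \<in> parcs G" for u v
    by (rule G.arcs_symmetric)
  have symH: "(u, v) \<in> parcs H \<Longrightarrow> (v, u) \<in> parcs H" for u v
    by (rule H.arcs_symmetric)
  have "parcs (G \<box> H) \<subseteq> (pverts G \<times> pverts H) \<times> (pverts G \<times> pverts H)"
    by (auto simp: cartesian_product_def)
  then have "finite (parcs (G \<box> H))" by (rule finite_subset) simp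
  then show ?thesis
    using G.no_loops H.no_loops
    by unfold_locales (auto simp: cartesian_product_def symmetric_def sym_def symG symH)
qed

lemma no_isolated_vertices_grid:
  assumes "2 \<le> a" "v \<in> pverts (path_graph a \<box> path_graph b)"
  shows "open_nbhd (path_graph a \<box> path_graph b) v \<noteq> {}"
proof -
  obtain i x where v: "v = (i, x)" "i < a" "x < b"
    using assms(2) by (auto simp: cartesian_product_def path_graph_def)
  have "(if i = 0 then 1 else i - 1, x) \<in> open_nbhd (path_graph a \<box> path_graph b) v"
    using assms(1) v by (auto simp: open_nbhd_def cartesian_product_def path_graph_def)
  then show ?thesis by blast
qed

end

theory Submission
  imports Defs "HOL-Computational_Algebra.Polynomial"
begin

text \<open>In any finite graph the forcing vertices of a skew forcing process form a legal open-neighbourhood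
  sequence, and a legal sequence read in the same order, with one newly dominated vertex chosen at each step,
  is a skew forcing process started from the unchosen vertices. Hence the two parameters add up to the number
  of vertices (\<open>grundy_total_plus_skew_forcing\<close>), and only the skew zero forcing number of the
  grid has to be determined.

  \<^emph>\<open>Upper bound.\<close> Call a vertex even or odd according to the sum of its coordinates: an
  even vertex forces only odd ones, and conversely. Let the even vertices force to the right and the odd
  vertices force to the left. For the first sweep it suffices that the odd vertices of the first column are
  blue, for the second that the even vertices of the last column are blue. These are \<open>a\<close> vertices
  in total, except when \<open>a\<close> is odd and \<open>b\<close> is even: then both columns contribute the
  smaller half \<open>(a - 1) / 2\<close>.

  \<^emph>\<open>Lower bound.\<close> Put a nonzero real weight on each arc. If a function on the vertices has
  weighted sum zero over every open neighbourhood, then its zero set is preserved by forcing. So no nonzero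
  vector of the kernel of the weighted adjacency matrix vanishes on a skew zero forcing set, whose size is
  therefore at least the dimension of the kernel (\<open>nullity_le_skew_forcing\<close>). Take weights coming
  from a weighting of each of the two paths. If \<open>f\<close> is an eigenvector of the first path for
  \<open>t\<close> and \<open>g\<close> one of the second path for \<open>-t\<close>, then \<open>f(i) *
  g(j)\<close> lies in the kernel. Weighted path spectra are symmetric about \<open>0\<close>, so each common
  eigenvalue contributes a kernel vector.

  It remains to make the spectra overlap as much as possible. Every finite symmetric set of reals is the
  spectrum of a weighted path (\<open>path_graph_with_spectrum\<close>): the polynomials orthogonal for the
  uniform measure on the set satisfy a three-term recurrence without diagonal term, and the last of them
  vanishes on the set, so evaluation at a point of the set is an eigenvector. Take symmetric sets of integers
  around \<open>0\<close> that contain \<open>0\<close> exactly when their size is odd. Those of sizes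
  \<open>a \<le> b\<close> share \<open>a\<close> points, except that \<open>0\<close> is lost when
  \<open>a\<close> is odd and \<open>b\<close> is even.\<close>

section \<open>Legal sequences and skew zero forcing\<close>

lemma skew_force_subset:
  assumes "(skew_force G)\<^sup>*\<^sup>* B C" and "B \<subseteq> pverts G"
  shows "B \<subseteq> C \<and> C \<subseteq> pverts G"
  using assms(1)
proof (induction rule: rtranclp_induct)
  case base
  then show ?case using assms(2) by simp
next
  case (step C D)
  then show ?case
    by (auto simp: skew_force_def open_nbhd_def)
qed

lemma legal_open_nbhd_seq_snoc:
  "legal_open_nbhd_seq G (vs @ [v]) \<longleftrightarrow>
     legal_open_nbhd_seq G vs \<and> v \<in> pverts G \<and>
     open_nbhd G v - (\<Union>u\<in>set vs. open_nbhd G u) \<noteq> {}"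
proof -
  have un: "(\<Union>j<length vs. open_nbhd G (vs ! j)) = (\<Union>u\<in>set vs. open_nbhd G u)"
    by (auto simp: set_conv_nth)
  have "(\<forall>i < length (vs @ [v]). open_nbhd G ((vs @ [v]) ! i)
            - (\<Union>j<i. open_nbhd G ((vs @ [v]) ! j)) \<noteq> {}) \<longleftrightarrow>
        (\<forall>i < length vs. open_nbhd G (vs ! i) - (\<Union>j<i. open_nbhd G (vs ! j)) \<noteq> {}) \<and>
        open_nbhd G v - (\<Union>u\<in>set vs. open_nbhd G u) \<noteq> {}"
    by (simp add: less_Suc_eq all_conj_distrib imp_conjR nth_append un[symmetric] disj_imp
        cong: conj_cong)
  then show ?thesis
    unfolding legal_open_nbhd_seq_def by auto
qed

text \<open>The forced vertex was white, whereas the neighbourhoods of all earlier forcing vertices are blue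
  by then; so the forced vertex is newly dominated. The last conjunct records this for the induction.\<close>

lemma forcing_gives_legal_seq:
  assumes "(skew_force G)\<^sup>*\<^sup>* B C" and "B \<subseteq> pverts G" and "finite (pverts G)"
  shows "\<exists>us. legal_open_nbhd_seq G us \<and> length us + card B = card C \<and>
              (\<Union>u\<in>set us. open_nbhd G u) \<subseteq> C"
  using assms(1)
proof (induction rule: rtranclp_induct)
  case base
  show ?case by (rule exI[of _ "[]"]) (simp add: legal_open_nbhd_seq_def)
next
  case (step C D)
  then obtain us where us: "legal_open_nbhd_seq G us" "length us + card B = card C"
    "(\<Union>u\<in>set us. open_nbhd G u) \<subseteq> C" by blast
  obtain u v where uv: "u \<in> pverts G" "open_nbhd G u - C = {v}" "D = insert v C"
    using step(2) by (auto simp: skew_force_def)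
  have "finite C"
    using skew_force_subset[OF step(1) assms(2)] assms(3) finite_subset by blast
  moreover have "v \<notin> C" "v \<in> open_nbhd G u" using uv(2) by auto
  ultimately have "length (us @ [u]) + card B = card D"
    using us(2) uv(3) by simp
  moreover have "v \<in> open_nbhd G u - (\<Union>u\<in>set us. open_nbhd G u)"
    using us(3) \<open>v \<notin> C\<close> \<open>v \<in> open_nbhd G u\<close> by blast
  then have "legal_open_nbhd_seq G (us @ [u])"
    using us(1) uv(1) unfolding legal_open_nbhd_seq_snoc by blast
  moreover have "(\<Union>u\<in>set (us @ [u]). open_nbhd G u) \<subseteq> D"
    using us(3) uv by auto
  ultimately show ?case by blast
qed

text \<open>\<open>W\<close> collects one newly dominated vertex per member of the sequence. The set
  \<open>X\<close> of vertices kept white serves the induction on the end of the sequence: the vertex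
  dominated only by the last member must stay white while the shorter sequence forces, which is possible
  because no earlier member is adjacent to it.\<close>

lemma legal_seq_gives_forcing:
  assumes "legal_open_nbhd_seq G vs"
  shows "\<exists>W \<subseteq> (\<Union>u\<in>set vs. open_nbhd G u). finite W \<and> card W = length vs \<and>
           (\<forall>X. X \<inter> (\<Union>u\<in>set vs. open_nbhd G u) = {} \<longrightarrow>
                (skew_force G)\<^sup>*\<^sup>* (pverts G - W - X) (pverts G - X))"
  using assms
proof (induction vs rule: rev_induct)
  case Nil
  show ?case by simp
next
  case (snoc v vs)
  let ?N = "\<Union>u\<in>set vs. open_nbhd G u"
  from snoc obtain W where W: "W \<subseteq> ?N" "finite W" "card W = length vs"
    "\<And>X. X \<inter> ?N = {} \<Longrightarrow> (skew_force G)\<^sup>*\<^sup>* (pverts G - W - X) (pverts G - X)"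
    by (auto simp: legal_open_nbhd_seq_snoc)
  from snoc.prems obtain w where w: "w \<in> open_nbhd G v" "w \<notin> ?N" and v: "v \<in> pverts G"
    by (auto simp: legal_open_nbhd_seq_snoc)
  have "(skew_force G)\<^sup>*\<^sup>* (pverts G - insert w W - X) (pverts G - X)"
    if X: "X \<inter> (\<Union>u\<in>set (vs @ [v]). open_nbhd G u) = {}" for X
  proof -
    have "insert w X \<inter> ?N = {}" using X w by auto
    from W(4)[OF this]
    have "(skew_force G)\<^sup>*\<^sup>* (pverts G - insert w W - X) (pverts G - insert w X)"
      by (simp add: Diff_insert2 set_diff_eq conj_ac)
    moreover have "skew_force G (pverts G - insert w X) (pverts G - X)"
    proof -
      have "w \<in> pverts G" using w(1) by (simp add: open_nbhd_def)
      then have "open_nbhd G v - (pverts G - insert w X) = {w}"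
        and "pverts G - X = insert w (pverts G - insert w X)"
        using X w by (auto simp: open_nbhd_def)
      then show ?thesis unfolding skew_force_def using v by blast
    qed
    ultimately show ?thesis by (rule rtranclp.rtrancl_into_rtrancl)
  qed
  moreover have "insert w W \<subseteq> (\<Union>u\<in>set (vs @ [v]). open_nbhd G u)" using W w by auto
  moreover have "card (insert w W) = length (vs @ [v])" using W w by (auto simp: card_insert_if)
  ultimately show ?case using W(2) by (metis finite_insert)
qed

lemma skew_zero_forcing_number_attained:
  assumes "finite (pverts G)"
  obtains B where "skew_zero_forcing_set G B" "card B = skew_zero_forcing_number G"
  using Min_in[OF skew_zero_forcing_cards_wf[OF assms]]
  unfolding skew_zero_forcing_number_def by auto

lemma skew_zero_forcing_number_le:
  assumes "finite (pverts G)" and "skew_zero_forcing_set G B"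
  shows "skew_zero_forcing_number G \<le> card B"
  using Min_le[OF skew_zero_forcing_cards_wf(1)[OF assms(1)]] assms(2)
  unfolding skew_zero_forcing_number_def by auto

theorem grundy_total_plus_skew_forcing:
  assumes fin: "finite (pverts G)"
  shows "grundy_total_domination_number G + skew_zero_forcing_number G = card (pverts G)"
proof (rule antisym)
  obtain vs where vs: "legal_open_nbhd_seq G vs" "length vs = grundy_total_domination_number G"
    using Max_in[OF legal_open_nbhd_seq_lengths_wf[OF fin]]
    unfolding grundy_total_domination_number_def by auto
  obtain W where W: "W \<subseteq> (\<Union>u\<in>set vs. open_nbhd G u)" "card W = length vs"
    "(skew_force G)\<^sup>*\<^sup>* (pverts G - W - {}) (pverts G - {})"
    using legal_seq_gives_forcing[OF vs(1)] by blast
  then have "skew_zero_forcing_set G (pverts G - W)"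
    by (simp add: skew_zero_forcing_set_def)
  then have "skew_zero_forcing_number G \<le> card (pverts G - W)"
    by (rule skew_zero_forcing_number_le[OF fin])
  moreover have "W \<subseteq> pverts G" using W(1) by (auto simp: open_nbhd_def)
  ultimately show "grundy_total_domination_number G + skew_zero_forcing_number G \<le> card (pverts G)"
    using W(2) vs(2) fin card_mono[OF fin \<open>W \<subseteq> pverts G\<close>]
    by (simp add: card_Diff_subset finite_subset)
next
  obtain B where B: "skew_zero_forcing_set G B" "card B = skew_zero_forcing_number G"
    by (rule skew_zero_forcing_number_attained[OF fin])
  obtain us where us: "legal_open_nbhd_seq G us" "length us + card B = card (pverts G)"
    using forcing_gives_legal_seq[of G B "pverts G"] B(1) fin
    unfolding skew_zero_forcing_set_def by blast
  have "length us \<le> grundy_total_domination_number G"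
    using Max_ge[OF legal_open_nbhd_seq_lengths_wf(1)[OF fin]] us(1)
    unfolding grundy_total_domination_number_def by auto
  then show "card (pverts G) \<le> grundy_total_domination_number G + skew_zero_forcing_number G"
    using us(2) B(2) by simp
qed

section \<open>Kernel vectors obstruct skew forcing\<close>

definition null_vector ::
  "'a pair_pre_digraph \<Rightarrow> ('a \<Rightarrow> 'a \<Rightarrow> real) \<Rightarrow> ('a \<Rightarrow> real) \<Rightarrow> bool" where
  "null_vector G w f \<longleftrightarrow> (\<forall>u \<in> pverts G. (\<Sum>v\<in>open_nbhd G u. w u v * f v) = 0)"

text \<open>A forcing vertex \<open>u\<close> has only zeros of \<open>f\<close> around it apart from the
  forced vertex \<open>v\<close>, so the relation at \<open>u\<close> reduces to \<open>w u v * f v =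
  0\<close>.\<close>

lemma null_vector_forced:
  assumes fin: "finite (pverts G)"
    and w: "\<And>u v. u \<in> pverts G \<Longrightarrow> v \<in> open_nbhd G u \<Longrightarrow> w u v \<noteq> 0"
    and f: "null_vector G w f"
    and force: "(skew_force G)\<^sup>*\<^sup>* B C" and B: "\<forall>v\<in>B. f v = 0"
  shows "\<forall>v\<in>C. f v = 0"
  using force
proof (induction rule: rtranclp_induct)
  case base
  show ?case using B .
next
  case (step C D)
  obtain u v where uv: "u \<in> pverts G" "open_nbhd G u - C = {v}" "D = insert v C"
    using step(2) by (auto simp: skew_force_def)
  have "finite (open_nbhd G u)" using fin by (simp add: open_nbhd_def)
  moreover have "{v} \<subseteq> open_nbhd G u" using uv(2) by auto
  moreover have "\<forall>x\<in>open_nbhd G u - {v}. w u x * f x = 0" using uv(2) step.IH by auto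
  ultimately have "(\<Sum>x\<in>open_nbhd G u. w u x * f x) = (\<Sum>x\<in>{v}. w u x * f x)"
    by (intro sum.mono_neutral_right)
  then have "w u v * f v = 0" using f uv(1) by (simp add: null_vector_def)
  then have "f v = 0" using w[OF uv(1)] \<open>{v} \<subseteq> open_nbhd G u\<close> by auto
  then show ?case using step.IH uv(3) by simp
qed

text \<open>Gaussian elimination: the equation \<open>v0\<close> is solved for a pivot \<open>t\<close> and
  substituted into the others, and \<open>r\<close> is the value that back substitution gives to
  \<open>t\<close>.\<close>

lemma underdetermined_system:
  fixes F :: "'b \<Rightarrow> 'c \<Rightarrow> real"
  assumes "finite B" "finite S" "card B < card S"
  shows "\<exists>\<alpha>. (\<exists>s\<in>S. \<alpha> s \<noteq> 0) \<and> (\<forall>v\<in>B. (\<Sum>s\<in>S. \<alpha> s * F v s) = 0)"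
  using assms
proof (induction B arbitrary: S F rule: finite_induct)
  case empty
  then have "S \<noteq> {}" by auto
  then show ?case by (intro exI[of _ "\<lambda>_. 1"]) auto
next
  case (insert v0 B)
  show ?case
  proof (cases "\<forall>s\<in>S. F v0 s = 0")
    case True
    have "card B < card S" using insert by simp
    from insert.IH[OF insert.prems(1) this, of F] show ?thesis using True by auto
  next
    case False
    then obtain t where t: "t \<in> S" "F v0 t \<noteq> 0" by blast
    define S' where "S' = S - {t}"
    have S: "S = insert t S'" "t \<notin> S'" "finite S'" using t insert.prems by (auto simp: S'_def)
    have "card B < card S'" using insert S by simp
    from insert.IH[OF S(3) this, of "\<lambda>v s. F v s - F v t * (F v0 s / F v0 t)"]
    obtain \<alpha> where \<alpha>: "\<exists>s\<in>S'. \<alpha> s \<noteq> 0"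
      "\<And>v. v \<in> B \<Longrightarrow> (\<Sum>s\<in>S'. \<alpha> s * (F v s - F v t * (F v0 s / F v0 t))) = 0" by blast
    define r where "r = - (\<Sum>s\<in>S'. \<alpha> s * F v0 s) / F v0 t"
    define \<beta> where "\<beta> = \<alpha>(t := r)"
    have sum: "(\<Sum>s\<in>S. \<beta> s * F v s) = r * F v t + (\<Sum>s\<in>S'. \<alpha> s * F v s)" for v
    proof -
      have "(\<Sum>s\<in>S'. \<beta> s * F v s) = (\<Sum>s\<in>S'. \<alpha> s * F v s)"
        using S(2) by (intro sum.cong) (auto simp: \<beta>_def)
      then show ?thesis using S by (simp add: \<beta>_def)
    qed
    have "(\<Sum>s\<in>S. \<beta> s * F v s) = 0" if "v \<in> insert v0 B" for v
    proof (cases "v = v0")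
      case True
      then show ?thesis using t(2) by (simp add: sum r_def)
    next
      case False
      then have "v \<in> B" using that by simp
      have "(\<Sum>s\<in>S'. \<alpha> s * (F v s - F v t * (F v0 s / F v0 t)))
          = (\<Sum>s\<in>S'. \<alpha> s * F v s) - (\<Sum>s\<in>S'. \<alpha> s * F v0 s) * (F v t / F v0 t)"
        by (simp add: right_diff_distrib sum_subtractf sum_distrib_left sum_divide_distrib mult_ac)
      then show ?thesis using \<alpha>(2)[OF \<open>v \<in> B\<close>] by (simp add: sum r_def)
    qed
    moreover have "\<exists>s\<in>S. \<beta> s \<noteq> 0" using \<alpha>(1) S by (auto simp: \<beta>_def)
    ultimately show ?thesis by blast
  qed
qed

text \<open>With fewer than \<open>card S\<close> blue vertices, some nontrivial combination of the kernel
  vectors would vanish on all of them, hence everywhere by \<open>null_vector_forced\<close>.\<close>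

lemma nullity_le_skew_forcing:
  assumes fin: "finite (pverts G)" "finite S"
    and w: "\<And>u v. u \<in> pverts G \<Longrightarrow> v \<in> open_nbhd G u \<Longrightarrow> w u v \<noteq> 0"
    and f: "\<And>s. s \<in> S \<Longrightarrow> null_vector G w (f s)"
    and indep: "\<And>\<alpha> s. \<forall>v\<in>pverts G. (\<Sum>s\<in>S. \<alpha> s * f s v) = 0 \<Longrightarrow> s \<in> S \<Longrightarrow> \<alpha> s = 0"
  shows "card S \<le> skew_zero_forcing_number G"
proof (rule ccontr)
  obtain B where B: "skew_zero_forcing_set G B" "card B = skew_zero_forcing_number G"
    by (rule skew_zero_forcing_number_attained[OF fin(1)])
  assume "\<not> card S \<le> skew_zero_forcing_number G"
  then have "card B < card S" using B(2) by simp
  moreover have "finite B" using B(1) fin(1) finite_subset by (auto simp: skew_zero_forcing_set_def)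
  ultimately obtain \<alpha> where \<alpha>: "\<exists>s\<in>S. \<alpha> s \<noteq> 0" "\<forall>v\<in>B. (\<Sum>s\<in>S. \<alpha> s * f s v) = 0"
    using underdetermined_system[of B S "\<lambda>v s. f s v"] fin(2) by blast
  have "null_vector G w (\<lambda>v. \<Sum>s\<in>S. \<alpha> s * f s v)"
    unfolding null_vector_def
  proof
    fix u assume u: "u \<in> pverts G"
    have "(\<Sum>v\<in>open_nbhd G u. w u v * (\<Sum>s\<in>S. \<alpha> s * f s v))
        = (\<Sum>v\<in>open_nbhd G u. \<Sum>s\<in>S. \<alpha> s * (w u v * f s v))"
      by (simp add: sum_distrib_left mult_ac)
    also have "\<dots> = (\<Sum>s\<in>S. \<alpha> s * (\<Sum>v\<in>open_nbhd G u. w u v * f s v))"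
      by (subst sum.swap) (simp add: sum_distrib_left)
    also have "\<dots> = 0" using f u by (simp add: null_vector_def)
    finally show "(\<Sum>v\<in>open_nbhd G u. w u v * (\<Sum>s\<in>S. \<alpha> s * f s v)) = 0" .
  qed
  from null_vector_forced[OF fin(1) w this _ \<alpha>(2)] B(1)
  have "\<forall>v\<in>pverts G. (\<Sum>s\<in>S. \<alpha> s * f s v) = 0"
    by (auto simp: skew_zero_forcing_set_def)
  then show False using indep \<alpha>(1) by blast
qed

section \<open>Weighted paths with a prescribed symmetric spectrum\<close>

definition moment :: "real set \<Rightarrow> nat \<Rightarrow> real poly \<Rightarrow> real" where
  "moment L k p = (\<Sum>x\<in>L. x ^ k * poly p x)"

text \<open>The monic orthogonal polynomials of the uniform measure on \<open>L\<close>. In general the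
  recurrence is \<open>p (k + 2) = (x - d) * p (k + 1) - c * p k\<close>; for symmetric \<open>L\<close> the
  coefficients \<open>d\<close> vanish by parity. They are the diagonal entries of the path matrix, which must
  be zero because a vertex is not its own neighbour. Moments stand in for the inner products: \<open>moment L
  k (p k)\<close> is the squared norm of \<open>p k\<close>, since \<open>p k\<close> is monic and orthogonal
  to lower powers.\<close>

fun orth_poly :: "real set \<Rightarrow> nat \<Rightarrow> real poly" where
  "orth_poly L 0 = 1"
| "orth_poly L (Suc 0) = [:0, 1:]"
| "orth_poly L (Suc (Suc k)) = pCons 0 (orth_poly L (Suc k))
     - smult (moment L (Suc k) (orth_poly L (Suc k)) / moment L k (orth_poly L k)) (orth_poly L k)"

lemma orth_poly_parity: "poly (orth_poly L k) (- x) = (- 1) ^ k * poly (orth_poly L k) x"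
  by (induction L k rule: orth_poly.induct) (simp_all add: algebra_simps)

lemma orth_poly_monic: "coeff (orth_poly L k) k = 1 \<and> (\<forall>i>k. coeff (orth_poly L k) i = 0)"
proof (induction L k rule: orth_poly.induct)
  case (2 L)
  show ?case by (auto simp: coeff_pCons split: nat.split)
next
  case (3 L k)
  then show ?case by (auto simp: coeff_pCons split: nat.split)
qed auto

lemma sum_poly_mult_moments:
  "(\<Sum>x\<in>L. poly g x * poly q x) = (\<Sum>i\<le>degree g. coeff g i * moment L i q)"
proof -
  have "(\<Sum>x\<in>L. poly g x * poly q x) = (\<Sum>x\<in>L. \<Sum>i\<le>degree g. coeff g i * (x ^ i * poly q x))"
    by (simp add: poly_altdef sum_distrib_right mult_ac)
  also have "\<dots> = (\<Sum>i\<le>degree g. coeff g i * moment L i q)"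
    by (subst sum.swap) (simp add: moment_def sum_distrib_left)
  finally show ?thesis .
qed

text \<open>The moment is the squared norm of a polynomial with too few roots to vanish on \<open>L\<close>.
  Up to this degree the recurrence coefficients are therefore well defined and nonzero.\<close>

lemma moment_orth_poly_pos:
  assumes fin: "finite L" and k: "k < card L"
    and orth: "\<And>i. i < k \<Longrightarrow> moment L i (orth_poly L k) = 0"
  shows "moment L k (orth_poly L k) > 0"
proof -
  let ?p = "orth_poly L k"
  have deg: "degree ?p = k"
    using orth_poly_monic[of L k] by (metis degree_le le_antisym le_degree one_neq_zero)
  have "(\<Sum>x\<in>L. poly ?p x * poly ?p x) = (\<Sum>i\<in>{k}. coeff ?p i * moment L i ?p)"
    unfolding sum_poly_mult_moments deg
    by (rule sum.mono_neutral_right) (auto simp: orth)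
  then have eq: "moment L k ?p = (\<Sum>x\<in>L. poly ?p x * poly ?p x)"
    using orth_poly_monic[of L k] by simp
  have nz: "?p \<noteq> 0" using orth_poly_monic[of L k] by auto
  have "\<exists>x\<in>L. poly ?p x \<noteq> 0"
  proof (rule ccontr)
    assume "\<not> ?thesis"
    then have "card L \<le> card {x. poly ?p x = 0}"
      using poly_roots_finite[OF nz] by (intro card_mono) auto
    also have "\<dots> \<le> k" using card_poly_roots_bound[OF nz] deg by simp
    finally show False using k by simp
  qed
  then obtain y where y: "y \<in> L" "poly ?p y \<noteq> 0" by blast
  have "0 < poly ?p y * poly ?p y" using y(2) by (auto simp: zero_less_mult_iff)
  also have "\<dots> \<le> (\<Sum>x\<in>L. poly ?p x * poly ?p x)"
    using member_le_sum[of y L "\<lambda>x. poly ?p x * poly ?p x"] y(1) fin by simp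
  finally show ?thesis using eq by simp
qed

lemma sum_odd_symmetric:
  fixes h :: "real \<Rightarrow> real"
  assumes "\<And>x. x \<in> L \<Longrightarrow> - x \<in> L" and "\<And>x. h (- x) = - h x"
  shows "(\<Sum>x\<in>L. h x) = 0"
proof -
  have "(\<Sum>x\<in>L. h x) = (\<Sum>x\<in>L. h (- x))"
    by (rule sum.reindex_bij_witness[of _ uminus uminus]) (auto simp: assms)
  then show ?thesis by (simp add: assms(2) sum_negf)
qed

lemma orth_poly_orthogonal:
  assumes fin: "finite L" and sym: "\<And>x. x \<in> L \<Longrightarrow> - x \<in> L"
  shows "k \<le> card L \<Longrightarrow> i < k \<Longrightarrow> moment L i (orth_poly L k) = 0"
proof (induction k arbitrary: i rule: less_induct)
  case (less k)
  consider "k = 0" | "k = Suc 0" | m where "k = Suc (Suc m)" by (metis nat.exhaust)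
  then show ?case
  proof cases
    case 1
    then show ?thesis using less by simp
  next
    case 2
    then show ?thesis using less sum_odd_symmetric[of L "\<lambda>x. x"] sym by (simp add: moment_def)
  next
    case 3
    define c where "c = moment L (Suc m) (orth_poly L (Suc m)) / moment L m (orth_poly L m)"
    have rec: "moment L i (orth_poly L k)
        = moment L (Suc i) (orth_poly L (Suc m)) - c * moment L i (orth_poly L m)"
      unfolding 3 orth_poly.simps c_def[symmetric]
      by (simp add: moment_def algebra_simps sum_subtractf sum_distrib_left)
    consider "i < m" | "i = m" | "i = Suc m" using less.prems 3 by linarith
    then show ?thesis
    proof cases
      case 1
      then show ?thesis using rec less.IH[of "Suc m" "Suc i"] less.IH[of m i] less.prems 3 by simp
    next
      \<comment> \<open>This case is what the recurrence coefficient is chosen for.\<close>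
      case 2
      have "moment L m (orth_poly L m) > 0"
        using less.IH[of m] less.prems 3 by (intro moment_orth_poly_pos[OF fin]) auto
      then show ?thesis using rec 2 by (simp add: c_def)
    next
      \<comment> \<open>Here the recurrence gives nothing, but the summand is an odd function.\<close>
      case i: 3
      have "(- x) ^ Suc m * poly (orth_poly L (Suc (Suc m))) (- x)
          = - (x ^ Suc m * poly (orth_poly L (Suc (Suc m))) x)" for x
        unfolding orth_poly_parity power_minus[of x "Suc m"] by simp
      then show ?thesis unfolding moment_def 3 i by (intro sum_odd_symmetric sym)
    qed
  qed
qed

text \<open>Test against the Lagrange polynomial that vanishes on \<open>S\<close> except at
  \<open>y\<close>.\<close>

lemma weights_zero_if_annihilate_polys:
  fixes \<omega> :: "real \<Rightarrow> real"
  assumes fin: "finite S" and y: "y \<in> S"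
    and ann: "\<And>g. degree g < card S \<Longrightarrow> (\<Sum>x\<in>S. \<omega> x * poly g x) = 0"
  shows "\<omega> y = 0"
proof -
  define g :: "real poly" where "g = (\<Prod>z\<in>S - {y}. [:- z, 1:])"
  have "degree g = card (S - {y})"
    unfolding g_def by (subst degree_prod_eq_sum_degree) auto
  then have "degree g < card S" using card_Diff1_less[OF fin y] by simp
  then have "0 = (\<Sum>x\<in>S. \<omega> x * poly g x)" using ann by simp
  also have "\<dots> = (\<Sum>x\<in>{y}. \<omega> x * poly g x)"
    using fin y by (intro sum.mono_neutral_right) (auto simp: g_def poly_prod)
  finally have "\<omega> y * poly g y = 0" by simp
  moreover have "poly g y \<noteq> 0" using fin by (auto simp: g_def poly_prod)
  ultimately show ?thesis by simp
qed

text \<open>The values of this polynomial on \<open>L\<close> are orthogonal to all polynomials of smaller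
  degree, and these realise every function on \<open>L\<close>.\<close>

lemma orth_poly_vanishes:
  assumes fin: "finite L" and sym: "\<And>x. x \<in> L \<Longrightarrow> - x \<in> L" and "y \<in> L"
  shows "poly (orth_poly L (card L)) y = 0"
proof (rule weights_zero_if_annihilate_polys[OF fin \<open>y \<in> L\<close>])
  fix g :: "real poly" assume "degree g < card L"
  then have "(\<Sum>x\<in>L. poly g x * poly (orth_poly L (card L)) x) = 0"
    unfolding sum_poly_mult_moments using orth_poly_orthogonal[OF fin sym]
    by (intro sum.neutral) auto
  then show "(\<Sum>x\<in>L. poly (orth_poly L (card L)) x * poly g x) = 0" by (simp add: mult.commute)
qed

text \<open>Monic polynomials of all degrees below \<open>m\<close> span the polynomials of degree below
  \<open>m\<close>.\<close>

lemma annihilate_monic_family: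
  fixes p :: "nat \<Rightarrow> real poly"
  assumes p: "\<And>k. coeff (p k) k = 1 \<and> (\<forall>i>k. coeff (p k) i = 0)"
    and ann: "\<And>k. k < m \<Longrightarrow> (\<Sum>x\<in>S. \<omega> x * poly (p k) x) = 0"
  shows "degree g < m \<Longrightarrow> (\<Sum>x\<in>S. \<omega> x * poly g x) = 0"
proof (induction "degree g" arbitrary: g rule: less_induct)
  case less
  define h where "h = g - smult (lead_coeff g) (p (degree g))"
  have coeff_h: "coeff h i = 0" if "i \<ge> degree g" for i
    using that p[of "degree g"] by (cases "i = degree g") (auto simp: h_def coeff_eq_0)
  have "(\<Sum>x\<in>S. \<omega> x * poly h x) = 0"
  proof (cases "h = 0")
    case False
    then have "degree h < degree g" by (metis coeff_h leading_coeff_neq_0 not_le)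
    then show ?thesis using less by simp
  qed simp
  moreover have "(\<Sum>x\<in>S. \<omega> x * poly g x) = (\<Sum>x\<in>S. \<omega> x * poly h x)
      + lead_coeff g * (\<Sum>x\<in>S. \<omega> x * poly (p (degree g)) x)"
    by (simp add: h_def algebra_simps sum_subtractf sum_distrib_left)
  ultimately show ?case using ann[OF less.prems] by simp
qed

lemma open_nbhd_path_graph:
  assumes "i < n"
  shows "open_nbhd (path_graph n) i
       = (if Suc i < n then {Suc i} else {}) \<union> (if i = 0 then {} else {i - 1})"
  using assms by (auto simp: open_nbhd_def path_graph_def)

text \<open>The recurrence \<open>x * p i = p (i + 1) + c i * p (i - 1)\<close> is the eigenvector equation of
  the path with weight \<open>1\<close> to the right and \<open>c i\<close> to the left. At the right end it
  holds because \<open>p n\<close> vanishes on \<open>L\<close>.\<close>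

lemma path_graph_with_spectrum:
  assumes fin: "finite L" and sym: "\<And>x. x \<in> L \<Longrightarrow> - x \<in> L" and n: "card L = n"
  obtains w :: "nat \<Rightarrow> nat \<Rightarrow> real" and p :: "nat \<Rightarrow> real poly"
  where "\<And>i j. i < n \<Longrightarrow> j \<in> open_nbhd (path_graph n) i \<Longrightarrow> w i j \<noteq> 0"
    and "\<And>k. coeff (p k) k = 1 \<and> (\<forall>i>k. coeff (p k) i = 0)"
    and "\<And>x i. x \<in> L \<Longrightarrow> i < n \<Longrightarrow>
           (\<Sum>j\<in>open_nbhd (path_graph n) i. w i j * poly (p j) x) = x * poly (p i) x"
proof -
  define h where "h k = moment L k (orth_poly L k)" for k
  define w where "w i j = (if j = Suc i then 1 else h i / h (i - 1))" for i j
  have h: "h k > 0" if "k < n" for k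
    unfolding h_def using that n orth_poly_orthogonal[OF fin sym]
    by (intro moment_orth_poly_pos[OF fin]) auto
  show thesis
  proof (rule that[of w "orth_poly L"])
    show "w i j \<noteq> 0" if "i < n" "j \<in> open_nbhd (path_graph n) i" for i j
    proof -
      have "h i > 0" "h (i - 1) > 0" using that(1) by (auto intro: h)
      then show ?thesis by (simp add: w_def)
    qed
    show "coeff (orth_poly L k) k = 1 \<and> (\<forall>i>k. coeff (orth_poly L k) i = 0)" for k
      by (rule orth_poly_monic)
    fix x i assume x: "x \<in> L" and i: "i < n"
    have last: "poly (orth_poly L (Suc i)) x = 0" if "\<not> Suc i < n"
      using that i n orth_poly_vanishes[OF fin sym x] by (metis Suc_lessI)
    have "(\<Sum>j\<in>open_nbhd (path_graph n) i. w i j * poly (orth_poly L j) x)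
        = poly (orth_poly L (Suc i)) x
          + (if i = 0 then 0 else w i (i - 1) * poly (orth_poly L (i - 1)) x)"
      unfolding open_nbhd_path_graph[OF i] using last by (auto simp: w_def)
    also have "\<dots> = x * poly (orth_poly L i) x"
      by (cases i) (simp_all add: w_def h_def)
    finally show "(\<Sum>j\<in>open_nbhd (path_graph n) i. w i j * poly (orth_poly L j) x)
        = x * poly (orth_poly L i) x" .
  qed
qed

section \<open>The lower bound for grids\<close>

lemma pverts_grid: "pverts (path_graph a \<box> path_graph b) = {0..<a} \<times> {0..<b}"
  by (simp add: cartesian_product_def path_graph_def)

lemma open_nbhd_cartesian_product:
  assumes "u \<in> pverts G" "x \<in> pverts H"
  shows "open_nbhd (G \<box> H) (u, x) = Pair u ` open_nbhd H x \<union> (\<lambda>v. (v, x)) ` open_nbhd G u"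
  using assms by (auto simp: open_nbhd_def cartesian_product_def)

text \<open>The weighted adjacency matrix of the product is the Kronecker sum of those of the factors, so the
  eigenvalues \<open>lam\<close> and \<open>- lam\<close> cancel.\<close>

lemma null_vector_cartesian_product:
  fixes lam :: real
  assumes fin: "finite (pverts G)" "finite (pverts H)"
    and loop: "\<And>u. u \<notin> open_nbhd G u"
    and f: "\<And>u. u \<in> pverts G \<Longrightarrow> (\<Sum>v\<in>open_nbhd G u. wG u v * f v) = lam * f u"
    and g: "\<And>x. x \<in> pverts H \<Longrightarrow> (\<Sum>y\<in>open_nbhd H x. wH x y * g y) = - lam * g x"
  shows "null_vector (G \<box> H) (\<lambda>(u, x) (v, y). if u = v then wH x y else wG u v)
           (\<lambda>(u, x). f u * g x)"
  unfolding null_vector_def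
proof
  fix ux assume "ux \<in> pverts (G \<box> H)"
  then obtain u x where ux: "ux = (u, x)" "u \<in> pverts G" "x \<in> pverts H"
    by (auto simp: cartesian_product_def)
  let ?w = "\<lambda>(u, x) (v, y). if u = v then wH x y else wG u v"
  let ?F = "\<lambda>vy. ?w ux vy * (case vy of (v, y) \<Rightarrow> f v * g y)"
  have finN: "finite (open_nbhd G u)" "finite (open_nbhd H x)"
    using fin by (auto simp: open_nbhd_def)
  have "(\<Sum>vy\<in>open_nbhd (G \<box> H) ux. ?F vy)
      = (\<Sum>vy\<in>Pair u ` open_nbhd H x. ?F vy) + (\<Sum>vy\<in>(\<lambda>v. (v, x)) ` open_nbhd G u. ?F vy)"
    unfolding ux(1) open_nbhd_cartesian_product[OF ux(2,3)]
    using finN loop by (intro sum.union_disjoint) auto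
  also have "(\<Sum>vy\<in>Pair u ` open_nbhd H x. ?F vy) = f u * (\<Sum>y\<in>open_nbhd H x. wH x y * g y)"
    by (subst sum.reindex) (auto simp: inj_on_def ux sum_distrib_left mult_ac)
  also have "(\<Sum>vy\<in>(\<lambda>v. (v, x)) ` open_nbhd G u. ?F vy)
      = g x * (\<Sum>v\<in>open_nbhd G u. wG u v * f v)"
  proof -
    have "(\<Sum>vy\<in>(\<lambda>v. (v, x)) ` open_nbhd G u. ?F vy)
        = (\<Sum>v\<in>open_nbhd G u. ?F (v, x))"
      by (subst sum.reindex) (auto simp: inj_on_def)
    also have "\<dots> = (\<Sum>v\<in>open_nbhd G u. g x * (wG u v * f v))"
      using loop[of u] by (intro sum.cong) (auto simp: ux)
    finally show ?thesis by (simp add: sum_distrib_left)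
  qed
  finally show "(\<Sum>vy\<in>open_nbhd (G \<box> H) ux. ?F vy) = 0"
    using f[OF ux(2)] g[OF ux(3)] by (simp add: algebra_simps)
qed

text \<open>Each common eigenvalue gives a kernel vector, and these vectors are independent because their
  restrictions to the first column evaluate polynomials of all degrees below \<open>a\<close> at distinct
  points.\<close>

lemma common_spectrum_le_skew_forcing_grid:
  fixes La Lb :: "real set"
  assumes La: "finite La" "\<And>x. x \<in> La \<Longrightarrow> - x \<in> La" "card La = a"
    and Lb: "finite Lb" "\<And>x. x \<in> Lb \<Longrightarrow> - x \<in> Lb" "card Lb = b"
    and b: "0 < b"
  shows "card (La \<inter> Lb) \<le> skew_zero_forcing_number (path_graph a \<box> path_graph b)"
proof -
  obtain wa p where
    wa: "\<And>i j. i < a \<Longrightarrow> j \<in> open_nbhd (path_graph a) i \<Longrightarrow> wa i j \<noteq> 0"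
    and p: "\<And>k. coeff (p k) k = 1 \<and> (\<forall>i>k. coeff (p k) i = 0)"
    and p_eig: "\<And>x i. x \<in> La \<Longrightarrow> i < a \<Longrightarrow>
           (\<Sum>j\<in>open_nbhd (path_graph a) i. wa i j * poly (p j) x) = x * poly (p i) x"
    by (rule path_graph_with_spectrum[OF La]) blast+
  obtain wb q where
    wb: "\<And>i j. i < b \<Longrightarrow> j \<in> open_nbhd (path_graph b) i \<Longrightarrow> wb i j \<noteq> 0"
    and q: "\<And>k. coeff (q k) k = 1 \<and> (\<forall>i>k. coeff (q k) i = 0)"
    and q_eig: "\<And>x i. x \<in> Lb \<Longrightarrow> i < b \<Longrightarrow>
           (\<Sum>j\<in>open_nbhd (path_graph b) i. wb i j * poly (q j) x) = x * poly (q i) x"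
    by (rule path_graph_with_spectrum[OF Lb]) blast+
  let ?G = "path_graph a \<box> path_graph b" and ?S = "La \<inter> Lb"
  define w where "w = (\<lambda>(u, x) (v, y). if u = (v::nat) then wb x (y::nat) else wa u v)"
  \<comment> \<open>The sign \<open>(- 1) ^ j\<close> turns an eigenvector for \<open>t\<close> into one for \<open>- t\<close>, as neighbours on a path have
    opposite parity.\<close>
  define f where "f t = (\<lambda>(i, j). poly (p i) t * ((- 1) ^ j * poly (q j) t))" for t
  have q0: "poly (q 0) t = 1" for t
  proof -
    have "q 0 = 1" using q[of 0] by (intro poly_eqI) (auto simp: coeff_1)
    then show ?thesis by simp
  qed
  show ?thesis
  proof (rule nullity_le_skew_forcing[where w = w and f = f])
    show "finite (pverts ?G)" by (simp add: pverts_grid)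
    show "finite ?S" using La(1) by simp
    show "w u v \<noteq> 0" if u': "u \<in> pverts ?G" and v: "v \<in> open_nbhd ?G u" for u v
    proof -
      obtain i j where u: "u = (i, j)" "i < a" "j < b" using u' by (auto simp: pverts_grid)
      then have "v \<in> Pair i ` open_nbhd (path_graph b) j
                   \<union> (\<lambda>k. (k, j)) ` open_nbhd (path_graph a) i"
        using v open_nbhd_cartesian_product[of i "path_graph a" j "path_graph b"]
        by (simp add: path_graph_def)
      moreover have "i \<notin> open_nbhd (path_graph a) i" by (simp add: open_nbhd_def path_graph_def)
      ultimately show ?thesis using wa[OF u(2)] wb[OF u(3)] by (auto simp: w_def u split: if_splits)
    qed
    show "null_vector ?G w (f t)" if t: "t \<in> ?S" for t
      unfolding w_def f_def
    proof (rule null_vector_cartesian_product[where lam = t])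
      show "(\<Sum>v\<in>open_nbhd (path_graph a) u. wa u v * poly (p v) t) = t * poly (p u) t"
        if "u \<in> pverts (path_graph a)" for u
        using p_eig t that by (simp add: path_graph_def)
      fix x assume "x \<in> pverts (path_graph b)"
      then have x: "x < b" by (simp add: path_graph_def)
      have "(\<Sum>y\<in>open_nbhd (path_graph b) x. wb x y * ((- 1) ^ y * poly (q y) t))
          = (\<Sum>y\<in>open_nbhd (path_graph b) x. - ((- 1) ^ x) * (wb x y * poly (q y) t))"
        by (intro sum.cong) (auto simp: open_nbhd_def path_graph_def)
      also have "\<dots> = - ((- 1) ^ x) * (t * poly (q x) t)"
        using q_eig[of t x] t x by (simp add: sum_distrib_left[symmetric] sum_negf)
      finally show "(\<Sum>y\<in>open_nbhd (path_graph b) x. wb x y * ((- 1) ^ y * poly (q y) t))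
          = - t * ((- 1) ^ x * poly (q x) t)" by simp
    qed (auto simp: path_graph_def open_nbhd_def)
    show "\<alpha> t = 0" if 0: "\<forall>v\<in>pverts ?G. (\<Sum>s\<in>?S. \<alpha> s * f s v) = 0" and t: "t \<in> ?S" for \<alpha> t
    proof (rule weights_zero_if_annihilate_polys[OF \<open>finite ?S\<close> t])
      fix g :: "real poly" assume g: "degree g < card ?S"
      have "card ?S \<le> a" using La by (metis card_mono inf_le1)
      then have deg: "degree g < a" using g by linarith
      have ann: "(\<Sum>s\<in>?S. \<alpha> s * poly (p k) s) = 0" if "k < a" for k
      proof -
        \<comment> \<open>In column \<open>0\<close> the second factor of every kernel vector is the constant \<open>1\<close>.\<close>
        have "(k, 0) \<in> pverts ?G" using that b by (simp add: pverts_grid)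
        from 0[rule_format, OF this] show ?thesis by (simp add: f_def q0)
      qed
      show "(\<Sum>s\<in>?S. \<alpha> s * poly g s) = 0"
        using p ann deg by (rule annihilate_monic_family)
    qed
  qed
qed

text \<open>The point \<open>0\<close> is omitted for even \<open>n\<close> because a symmetric set of even
  size cannot contain it.\<close>

definition spectrum_pts :: "nat \<Rightarrow> int set" where
  "spectrum_pts n = {- int (n div 2)..int (n div 2)} - (if even n then {0} else {})"

lemma card_spectrum_pts: "card (spectrum_pts n) = n"
proof (cases "even n")
  case True
  then have "card (spectrum_pts n) = nat (2 * int (n div 2) + 1) - 1"
    by (simp add: spectrum_pts_def card_Diff_subset)
  moreover have "2 * int (n div 2) = int n" using True by presburger
  ultimately show ?thesis by simp
next
  case False
  then have "card (spectrum_pts n) = nat (2 * int (n div 2) + 1)"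
    by (simp add: spectrum_pts_def)
  moreover have "2 * int (n div 2) + 1 = int n" using False by presburger
  ultimately show ?thesis by simp
qed

lemma skew_forcing_grid_ge:
  assumes "a \<le> b" "0 < b"
  shows "a - of_bool (odd a \<and> even b) \<le> skew_zero_forcing_number (path_graph a \<box> path_graph b)"
proof -
  let ?L = "\<lambda>n. real_of_int ` spectrum_pts n"
  have L: "finite (?L n)" "\<And>x. x \<in> ?L n \<Longrightarrow> - x \<in> ?L n" "card (?L n) = n" for n
  proof -
    show "finite (?L n)" by (simp add: spectrum_pts_def)
    show "- x \<in> ?L n" if x: "x \<in> ?L n" for x
    proof -
      obtain j where "x = of_int j" "j \<in> spectrum_pts n" using x by blast
      then have "- x = of_int (- j)" "- j \<in> spectrum_pts n"
        by (auto simp: spectrum_pts_def split: if_splits)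
      then show ?thesis by (rule image_eqI)
    qed
    show "card (?L n) = n" by (simp add: card_image inj_on_def card_spectrum_pts)
  qed
  have "a div 2 \<le> b div 2" using assms(1) by (rule div_le_mono)
  have "a - of_bool (odd a \<and> even b) = card (spectrum_pts a \<inter> spectrum_pts b)"
  proof (cases "odd a \<and> even b")
    case True
    then have "spectrum_pts a \<inter> spectrum_pts b = spectrum_pts a - {0}" "0 \<in> spectrum_pts a"
      using \<open>a div 2 \<le> b div 2\<close> by (auto simp: spectrum_pts_def)
    then show ?thesis using True card_spectrum_pts[of a] by (simp add: card_Diff_subset)
  next
    case False
    then have "spectrum_pts a \<inter> spectrum_pts b = spectrum_pts a"
      using \<open>a div 2 \<le> b div 2\<close> by (auto simp: spectrum_pts_def split: if_splits)
    then show ?thesis using False card_spectrum_pts[of a] by auto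
  qed
  also have "\<dots> = card (?L a \<inter> ?L b)"
    by (simp add: image_Int[symmetric] inj_on_def card_image)
  also have "\<dots> \<le> skew_zero_forcing_number (path_graph a \<box> path_graph b)"
    by (rule common_spectrum_le_skew_forcing_grid[OF L L assms(2)])
  finally show ?thesis .
qed

section \<open>An optimal forcing set for grids\<close>

lemma stalled_set_reachable:
  assumes "finite (pverts G)" "B \<subseteq> pverts G"
  shows "\<exists>C. (skew_force G)\<^sup>*\<^sup>* B C \<and> (\<forall>u\<in>pverts G. \<forall>v. open_nbhd G u - C \<noteq> {v})"
  using assms(2)
proof (induction "card (pverts G - B)" arbitrary: B rule: less_induct)
  case less
  show ?case
  proof (cases "\<forall>u\<in>pverts G. \<forall>v. open_nbhd G u - B \<noteq> {v}")
    case True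
    then show ?thesis by blast
  next
    case False
    then obtain u v where uv: "u \<in> pverts G" "open_nbhd G u - B = {v}" by blast
    then have v: "v \<in> pverts G" "v \<notin> B" by (auto simp: open_nbhd_def)
    have "card (pverts G - insert v B) < card (pverts G - B)"
      using v assms(1) by (intro psubset_card_mono) auto
    then obtain C where C: "(skew_force G)\<^sup>*\<^sup>* (insert v B) C"
      "\<forall>u\<in>pverts G. \<forall>v. open_nbhd G u - C \<noteq> {v}"
      using less v by blast
    have "skew_force G B (insert v B)" using uv by (auto simp: skew_force_def)
    then show ?thesis using C by (meson converse_rtranclp_into_rtranclp)
  qed
qed

text \<open>Forcing until no force is possible ends in a stalled set. So no order of the forces has to be
  exhibited: it suffices that every set containing \<open>B\<close> from which no force is possible is
  everything.\<close>

lemma skew_zero_forcing_setI: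
  assumes fin: "finite (pverts G)" and B: "B \<subseteq> pverts G"
    and stalled: "\<And>C v. B \<subseteq> C \<Longrightarrow> v \<in> pverts G \<Longrightarrow>
      (\<And>u x. u \<in> pverts G \<Longrightarrow> x \<in> open_nbhd G u \<Longrightarrow> open_nbhd G u - {x} \<subseteq> C \<Longrightarrow> x \<in> C) \<Longrightarrow> v \<in> C"
  shows "skew_zero_forcing_set G B"
proof -
  obtain C where C: "(skew_force G)\<^sup>*\<^sup>* B C" "\<forall>u\<in>pverts G. \<forall>v. open_nbhd G u - C \<noteq> {v}"
    using stalled_set_reachable[OF assms(1,2)] by blast
  have BC: "B \<subseteq> C" "C \<subseteq> pverts G" using skew_force_subset[OF C(1) B] by auto
  have "v \<in> C" if "u \<in> pverts G" "v \<in> open_nbhd G u" "open_nbhd G u - {v} \<subseteq> C" for u v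
  proof (rule ccontr)
    assume "v \<notin> C"
    then have "open_nbhd G u - C = {v}" using that by auto
    then show False using C(2) that(1) by blast
  qed
  then have "pverts G \<subseteq> C" using stalled[OF BC(1)] by blast
  then have "C = pverts G" using BC(2) by simp
  then show ?thesis using C(1) B by (simp add: skew_zero_forcing_set_def)
qed

lemma open_nbhd_grid:
  assumes "i < a" "j < b"
  shows "(k, l) \<in> open_nbhd (path_graph a \<box> path_graph b) (i, j) \<longleftrightarrow>
    k < a \<and> l < b \<and> (k = i \<and> (l = Suc j \<or> j = Suc l) \<or> l = j \<and> (k = Suc i \<or> i = Suc k))"
  using assms by (auto simp: open_nbhd_def cartesian_product_def path_graph_def)

definition grid_seed :: "nat \<Rightarrow> nat \<Rightarrow> (nat \<times> nat) set" where
  "grid_seed a b = {i. i < a \<and> odd i} \<times> {0} \<union> {i. i < a \<and> even (i + (b - 1))} \<times> {b - 1}"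

text \<open>Induction over the columns: from left to right for odd vertices, each forced by its left
  neighbour, and from right to left for even vertices, each forced by its right neighbour. All other
  neighbours of the forcing vertex have the parity in question and lie in columns already treated.\<close>

lemma skew_zero_forcing_set_grid_seed:
  assumes "0 < b"
  shows "skew_zero_forcing_set (path_graph a \<box> path_graph b) (grid_seed a b)"
proof (rule skew_zero_forcing_setI)
  let ?G = "path_graph a \<box> path_graph b"
  show "finite (pverts ?G)" "grid_seed a b \<subseteq> pverts ?G"
    using assms by (auto simp: pverts_grid grid_seed_def)
  fix C v
  assume seed: "grid_seed a b \<subseteq> C" and v: "v \<in> pverts ?G"
    and force: "\<And>u x. u \<in> pverts ?G \<Longrightarrow> x \<in> open_nbhd ?G u \<Longrightarrow> open_nbhd ?G u - {x} \<subseteq> C \<Longrightarrow> x \<in> C"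
  have odd_blue: "(i, j) \<in> C" if "i < a" "j < b" "odd (i + j)" for i j
    using that
  proof (induction j arbitrary: i rule: less_induct)
    case (less j)
    show ?case
    proof (cases j)
      case 0
      then show ?thesis using less.prems seed by (auto simp: grid_seed_def)
    next
      case (Suc k)
      show ?thesis
      proof (rule force[of "(i, k)"])
        show "(i, k) \<in> pverts ?G" using less.prems Suc by (simp add: pverts_grid)
        show "(i, j) \<in> open_nbhd ?G (i, k)" using less.prems Suc by (simp add: open_nbhd_grid)
        show "open_nbhd ?G (i, k) - {(i, j)} \<subseteq> C"
        proof
          fix w assume w: "w \<in> open_nbhd ?G (i, k) - {(i, j)}"
          obtain i' j' where [simp]: "w = (i', j')" by (cases w)
          have "i' < a" "j' < j" "odd (i' + j')"
            using w less.prems Suc by (auto simp: open_nbhd_grid)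
          then show "w \<in> C" using less.IH[of j' i'] less.prems by simp
        qed
      qed
    qed
  qed
  have even_blue: "(i, j) \<in> C" if "i < a" "j < b" "even (i + j)" for i j
    using that
  proof (induction "b - j" arbitrary: i j rule: less_induct)
    case less
    show ?case
    proof (cases "Suc j = b")
      case True
      then show ?thesis using less.prems seed by (auto simp: grid_seed_def)
    next
      case False
      show ?thesis
      proof (rule force[of "(i, Suc j)"])
        show "(i, Suc j) \<in> pverts ?G" using less.prems False by (simp add: pverts_grid)
        show "(i, j) \<in> open_nbhd ?G (i, Suc j)" using less.prems False by (simp add: open_nbhd_grid)
        show "open_nbhd ?G (i, Suc j) - {(i, j)} \<subseteq> C"
        proof
          fix w assume w: "w \<in> open_nbhd ?G (i, Suc j) - {(i, j)}"
          obtain i' j' where [simp]: "w = (i', j')" by (cases w)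
          have "i' < a" "j' < b" "j < j'" "even (i' + j')"
            using w less.prems False by (auto simp: open_nbhd_grid)
          then show "w \<in> C" using less.hyps[of j' i'] less.prems by simp
        qed
      qed
    qed
  qed
  obtain i j where "v = (i, j)" "i < a" "j < b" using v by (auto simp: pverts_grid)
  then show "v \<in> C" using odd_blue even_blue by blast
qed

lemma card_even_odd_below:
  "card {i. i < a \<and> even i} = (a + 1) div 2" "card {i. i < a \<and> odd i} = a div 2" for a :: nat
proof -
  have "card {i. i < a \<and> even i} = (a + 1) div 2 \<and> card {i. i < a \<and> odd i} = a div 2"
  proof (induction a)
    case (Suc a)
    have step: "{i. i < Suc a \<and> P i} = (if P a then insert a {i. i < a \<and> P i} else {i. i < a \<and> P i})"
      for P by (auto elim: less_SucE)
    have "even a \<Longrightarrow> Suc ((a + 1) div 2) = (Suc a + 1) div 2 \<and> a div 2 = Suc a div 2"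
      "odd a \<Longrightarrow> (a + 1) div 2 = (Suc a + 1) div 2 \<and> Suc (a div 2) = Suc a div 2"
      by presburger+
    then show ?case using Suc by (cases "even a") (simp_all add: step)
  qed simp
  then show "card {i. i < a \<and> even i} = (a + 1) div 2" "card {i. i < a \<and> odd i} = a div 2"
    by auto
qed

lemma card_grid_seed:
  assumes "2 \<le> b"
  shows "card (grid_seed a b) = a - of_bool (odd a \<and> even b)"
proof -
  have "card (grid_seed a b) = card {i. i < a \<and> odd i} + card {i. i < a \<and> even (i + (b - 1))}"
    unfolding grid_seed_def using assms
    by (subst card_Un_disjoint) (auto simp: card_cartesian_product)
  moreover have "{i. i < a \<and> even (i + (b - 1))}
      = (if even b then {i. i < a \<and> odd i} else {i. i < a \<and> even i})"
    using assms by auto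
  moreover have "even a \<Longrightarrow> a div 2 + (a + 1) div 2 = a \<and> a div 2 + a div 2 = a"
    "odd a \<Longrightarrow> a div 2 + (a + 1) div 2 = a \<and> a div 2 + a div 2 = a - 1"
    by presburger+
  ultimately show ?thesis
    by (cases "even a"; cases "even b") (simp_all add: card_even_odd_below)
qed

theorem theorem1p1:
  fixes a b :: nat
  assumes "2 \<le> a" and "a \<le> b"
  shows "int (skew_zero_forcing_number (path_graph a \<box> path_graph b))
           = int a - of_bool (odd a \<and> even b)
       \<and> int (grundy_total_domination_number (path_graph a \<box> path_graph b))
           = int a * int b - int a + of_bool (odd a \<and> even b)"
proof -
  let ?G = "path_graph a \<box> path_graph b"
  have fin: "finite (pverts ?G)" by (simp add: pverts_grid)
  have "skew_zero_forcing_number ?G \<le> a - of_bool (odd a \<and> even b)"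
    using skew_zero_forcing_number_le[OF fin skew_zero_forcing_set_grid_seed] card_grid_seed assms
    by auto
  moreover have "a - of_bool (odd a \<and> even b) \<le> skew_zero_forcing_number ?G"
    using skew_forcing_grid_ge assms by simp
  ultimately have Z: "int (skew_zero_forcing_number ?G) = int a - of_bool (odd a \<and> even b)"
    using assms by (simp add: of_bool_def split: if_splits)
  moreover have "int (grundy_total_domination_number ?G) + int (skew_zero_forcing_number ?G)
      = int a * int b"
    using grundy_total_plus_skew_forcing[OF fin]
    by (simp add: pverts_grid card_cartesian_product flip: of_nat_add of_nat_mult)
  ultimately show ?thesis by linarith
qed

end
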